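(* Let $\mathsf G$ be a connected finite combinatorial graph (multiple edges allowed, no loops) with at least two vertices, with $E$ edges and edge connectivity $\eta$. Then the lowest nonzero eigenvalue $\alpha_1(\mathsf G)$ of the normalized Laplacian $\mathcal L_{\rm norm}$ of $\mathsf G$ satisfies $$\alpha_1(\mathsf G)\ \ge\ 1-\cos\left(\frac{\pi\eta}{E+(\eta-2)_+}\right),$$ where $(x)_+=\max\{x,0\}$.
   Context: A combinatorial graph $\mathsf G$ has finite vertex set $\mathsf V$ and finite edge set $\mathsf E$, is connected, may have multiple edges between the same pair of vertices, and has no loops. The edge connectivity $\eta$ is the minimal number of edges whose removal disconnects $\mathsf G$. The degree $\deg(\mathsf v)$ is the number of edges incident to $\mathsf v$. With an arbitrary orientation of the edges ($\mathsf e_{init},\mathsf e_{term}$ denoting the initial and terminal endpoints of $\mathsf e$), $$\alpha_1(\mathsf G)=\inf\left\{\frac{\sum_{\mathsf e\in\mathsf E}|f(\mathsf e_{init})-f(\mathsf e_{term})|^2}{\sum_{\mathsf v\in\mathsf V}|f(\mathsf v)|^2\deg(\mathsf v)}\ :\ 0\ne f\in\mathbb R^{\mathsf V},\ \sum_{\mathsf v\in\mathsf V}f(\mathsf v)\deg(\mathsf v)=0\right\}\in[0,2].$$ *)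

theory Defs
  imports Complex_Main "Graph_Theory.Digraph_Component"
begin

text \<open>
  A multigraph is encoded by a loop-free \<open>pre_digraph\<close> having exactly one arc for each undirected
  edge; the direction of the arcs is the arbitrary orientation (\<open>tail\<close> = initial endpoint,
  \<open>head\<close> = terminal endpoint).  A pair of antiparallel arcs therefore stands for two parallel edges,
  not for a single undirected edge.

  \<open>Digraph_Component.connected\<close> ignores the direction of the arcs: it says that the underlying
  undirected graph is nonempty and connected.  It is written with its qualified name throughout
  because of the topological constant \<open>connected\<close>.
\<close>

definition undirected_degree :: "('a, 'b) pre_digraph \<Rightarrow> 'a \<Rightarrow> nat" where
  "undirected_degree G v = card {e \<in> arcs G. tail G e = v \<or> head G e = v}"

definition delete_arcs :: "('a, 'b) pre_digraph \<Rightarrow> 'b set \<Rightarrow> ('a, 'b) pre_digraph" where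
  "delete_arcs G F = G\<lparr>arcs := arcs G - F\<rparr>"

text \<open>
  If \<open>G\<close> is finite and has at least two vertices, deleting all arcs disconnects it, so the
  minimum below is over a nonempty set.
\<close>

definition edge_connectivity :: "('a, 'b) pre_digraph \<Rightarrow> nat" where
  "edge_connectivity G =
     (LEAST k. \<exists>F \<subseteq> arcs G. card F = k \<and> \<not> Digraph_Component.connected (delete_arcs G F))"

text \<open>
  For \<open>u = v\<close> this counts loops, so the diagonal vanishes for loop-free graphs.
\<close>

definition adjacency :: "('a, 'b) pre_digraph \<Rightarrow> 'a \<Rightarrow> 'a \<Rightarrow> nat" where
  "adjacency G u v = card {e \<in> arcs G. {tail G e, head G e} = {u, v}}"

definition laplacian :: "('a, 'b) pre_digraph \<Rightarrow> 'a \<Rightarrow> 'a \<Rightarrow> real" where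
  "laplacian G u v = (if u = v then real (undirected_degree G u) else 0) - real (adjacency G u v)"

text \<open>
  The matrix \<open>D\<^sup>-\<^sup>1\<^sup>/\<^sup>2 (D - A) D\<^sup>-\<^sup>1\<^sup>/\<^sup>2\<close>, with \<open>D\<close> the diagonal degree matrix and \<open>A\<close> the adjacency matrix.
\<close>

definition normalized_laplacian :: "('a, 'b) pre_digraph \<Rightarrow> 'a \<Rightarrow> 'a \<Rightarrow> real" where
  "normalized_laplacian G u v =
     laplacian G u v / (sqrt (undirected_degree G u) * sqrt (undirected_degree G v))"

text \<open>
  Vectors indexed by the vertex set are functions \<open>f :: 'a \<Rightarrow> real\<close> of which only the values on
  \<open>verts G\<close> matter; in particular \<open>f \<noteq> 0\<close> means that \<open>f\<close> does not vanish identically on \<open>verts G\<close>.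
  Real eigenvalues suffice because the normalized Laplacian is a real symmetric matrix.
\<close>

definition normalized_laplacian_eigenvalues :: "('a, 'b) pre_digraph \<Rightarrow> real set" where
  "normalized_laplacian_eigenvalues G =
     {l. \<exists>f :: 'a \<Rightarrow> real. (\<exists>v \<in> verts G. f v \<noteq> 0) \<and>
           (\<forall>u \<in> verts G. (\<Sum>v \<in> verts G. normalized_laplacian G u v * f v) = l * f u)}"

definition alpha1 :: "('a, 'b) pre_digraph \<Rightarrow> real" where
  "alpha1 G = Inf
     {(\<Sum>e \<in> arcs G. \<bar>f (tail G e) - f (head G e)\<bar>\<^sup>2)
        / (\<Sum>v \<in> verts G. \<bar>f v\<bar>\<^sup>2 * real (undirected_degree G v)) |
      f :: 'a \<Rightarrow> real. (\<exists>v \<in> verts G. f v \<noteq> 0) \<and>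
        (\<Sum>v \<in> verts G. f v * real (undirected_degree G v)) = 0}"

end

theory Submission
  imports Defs "HOL-Analysis.Function_Topology" "HOL-Analysis.Elementary_Metric_Spaces"
begin

text \<open>
  The infimum defining \<open>alpha1 G\<close> is attained by compactness, and the first variation at a minimiser \<open>f\<close> is the
  eigenvalue equation (\<open>alpha1_eigenfunction\<close>); connectedness makes the minimum positive, and every eigenvector
  of a nonzero eigenvalue competes in the infimum.
  
  The lower bound is at most \<open>2\<close>, so it remains to treat \<open>alpha1 G = 1 - cos k\<close> with \<open>0 < k < pi\<close>. Replace each edge by an interval of length
  \<open>k\<close> and extend \<open>f\<close> into the edges by solutions \<open>u\<close> of \<open>u'' = - u\<close>. The discrete eigenvalue equation then says
  that the outgoing derivatives of \<open>u\<close> add up to zero at every vertex, and partial integration yields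
  \<open>\<integral> (u'\<^sup>2 - u\<^sup>2) = 0\<close> over the set where \<open>u > 0\<close> (\<open>pos_flux_sum_zero\<close>). Let \<open>A\<close> be the maximum of \<open>u\<close>. The pointwise
  inequality
  \<open>1 - (u / A)\<^sup>2 + (u' / A)\<^sup>2 \<ge> 2 * \<bar>u' / A\<bar> * sqrt (1 - (u / A)\<^sup>2)\<close>
  has as its right hand side the speed of \<open>H (u / A)\<close>, where \<open>H\<close> is the function \<open>disc_area\<close>. Integration shows that
  the length of the positive set is at least the total variation of \<open>H (u / A)\<close> on it
  (\<open>oscillation_bound\<close>, \<open>nodal_split_exists\<close>).
  
  Let \<open>\<eta>\<close> be the edge connectivity. Each level between \<open>0\<close> and the largest vertex value \<open>M\<close> separates vertices,
  so at least \<open>\<eta>\<close> edges cross it (\<open>cut_coarea\<close>). Levels between \<open>M\<close> and \<open>A\<close> are still taken twice on the edge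
  that carries the maximum, and \<open>M \<ge> A * cos (k / 2)\<close> implies that these levels span an \<open>H\<close>-range of at most \<open>k / 2\<close>.
  As \<open>H 1 = pi / 2\<close>, the positive set has length at least \<open>\<eta> * pi / 2 - max (\<eta> - 2) 0 * k / 2\<close>
  (\<open>positive_part_length\<close>). The same holds for the negative set, and both lengths together are at most \<open>k\<close> times
  the number of edges.
\<close>

section \<open>An area comparison for harmonic oscillators\<close>

text \<open>
  This is \<open>\<integral>\<^sub>0\<^sup>t 2 * sqrt (1 - s\<^sup>2) ds\<close>, the signed area of the part of the unit disc between the
  abscissae \<open>0\<close> and \<open>t\<close>.
\<close>

definition disc_area :: "real \<Rightarrow> real" where
  "disc_area t = arcsin t + t * sqrt (1 - t\<^sup>2)"

lemma disc_area_0 [simp]: "disc_area 0 = 0"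
  by (simp add: disc_area_def)

lemma disc_area_1 [simp]: "disc_area 1 = pi / 2"
  by (simp add: disc_area_def)

lemma continuous_on_disc_area: "continuous_on {-1..1} disc_area"
  unfolding disc_area_def by (intro continuous_intros) auto

lemma has_derivative_disc_area:
  assumes "\<bar>t\<bar> < 1"
  shows "(disc_area has_real_derivative 2 * sqrt (1 - t\<^sup>2)) (at t)"
proof -
  have t: "1 - t\<^sup>2 > 0" "-1 < t" "t < 1"
    using assms abs_square_less_1[of t] by auto
  define r where "r = sqrt (1 - t\<^sup>2)"
  have r: "r > 0" "r * r = 1 - t * t" using t by (auto simp: r_def power2_eq_square)
  have D: "(disc_area has_real_derivative
      inverse r + (1 * r + (inverse r / 2 * (- (2 * t))) * t)) (at t)"
    unfolding disc_area_def r_def using t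
    by (auto intro!: derivative_eq_intros)
  have eq: "inverse r + (1 * r + (inverse r / 2 * (- (2 * t))) * t) = 2 * r"
    using r by (simp add: field_simps)
  show ?thesis using D unfolding eq by (simp only: r_def)
qed

lemma disc_area_mono:
  assumes "-1 \<le> s" "s \<le> t" "t \<le> 1"
  shows "disc_area s \<le> disc_area t"
proof (rule DERIV_nonneg_imp_increasing_open[where f = disc_area])
  fix x assume "s < x" "x < t"
  then have "\<bar>x\<bar> < 1" using assms by auto
  then show "\<exists>y. DERIV disc_area x :> y \<and> 0 \<le> y"
    using has_derivative_disc_area[of x] abs_square_less_1[of x]
    by (intro exI[of _ "2 * sqrt (1 - x\<^sup>2)"]) auto
next
  show "continuous_on {s..t} disc_area"
    by (rule continuous_on_subset[OF continuous_on_disc_area]) (use assms in auto)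
qed (use assms in auto)

lemma arcsin_le_disc_area: "0 \<le> t \<Longrightarrow> t \<le> 1 \<Longrightarrow> arcsin t \<le> disc_area t"
  by (simp add: disc_area_def abs_square_le_1)

text \<open>
  The derivative of \<open>t + u * v\<close> is \<open>1 - u\<^sup>2 + v\<^sup>2\<close> and that of \<open>disc_area \<circ> u\<close> is
  \<open>2 * v * sqrt (1 - u\<^sup>2)\<close>. For either sign \<open>s\<close>, the derivative of \<open>t + u * v - s * (disc_area \<circ> u)\<close> is
  therefore the square \<open>(sqrt (1 - u\<^sup>2) - s * v)\<^sup>2\<close>. For \<open>u = cos\<close> on \<open>[0, pi]\<close> the square with \<open>s = -1\<close> vanishes
  identically: a cosine arc of full height loses nothing in the bound.
\<close>

lemma oscillation_bound_strict:
  fixes u v :: "real \<Rightarrow> real"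
  assumes "x \<le> y"
    and u: "\<And>t. t \<in> {x..y} \<Longrightarrow> (u has_real_derivative v t) (at t)"
    and v: "\<And>t. t \<in> {x..y} \<Longrightarrow> (v has_real_derivative - u t) (at t)"
    and b: "\<And>t. t \<in> {x..y} \<Longrightarrow> \<bar>u t\<bar> < 1"
  shows "\<bar>disc_area (u y) - disc_area (u x)\<bar> \<le> y - x + u y * v y - u x * v x"
proof -
  have "x + u x * v x - s * disc_area (u x) \<le> y + u y * v y - s * disc_area (u y)"
    if s: "s \<in> {1, -1}" for s :: real
  proof (rule DERIV_nonneg_imp_nondecreasing[OF \<open>x \<le> y\<close>])
    fix t assume "x \<le> t" "t \<le> y"
    then have t: "t \<in> {x..y}" by simp
    define r where "r = sqrt (1 - (u t)\<^sup>2)"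
    have r: "r * r = 1 - u t * u t"
      using b[OF t] abs_square_less_1[of "u t"] by (auto simp: r_def power2_eq_square)
    have C: "((\<lambda>t. disc_area (u t)) has_real_derivative 2 * r * v t) (at t)"
      unfolding r_def
      by (rule DERIV_chain2[where f = disc_area and g = u, OF has_derivative_disc_area[OF b[OF t]] u[OF t]])
    have D: "((\<lambda>t. t + u t * v t - s * disc_area (u t)) has_real_derivative
        1 + (v t * v t + - u t * u t) - s * (2 * r * v t)) (at t)"
      by (rule DERIV_diff DERIV_add DERIV_ident DERIV_mult DERIV_cmult u[OF t] v[OF t] C)+
    have "s * s = 1" using s by auto
    then have "1 + (v t * v t + - u t * u t) - s * (2 * r * v t) = r * r - 2 * (s * r * v t) + (s * s) * (v t * v t)"
      unfolding r by (simp add: algebra_simps)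
    also have "\<dots> = (r - s * v t)\<^sup>2" by (simp add: power2_eq_square algebra_simps)
    finally have eq: "1 + (v t * v t + - u t * u t) - s * (2 * r * v t) = (r - s * v t)\<^sup>2" .
    show "\<exists>z. ((\<lambda>t. t + u t * v t - s * disc_area (u t)) has_real_derivative z) (at t) \<and> 0 \<le> z"
      using D unfolding eq by (intro exI[of _ "(r - s * v t)\<^sup>2"] conjI zero_le_power2)
  qed
  from this[of 1] this[of "-1"] show ?thesis by simp
qed

text \<open>
  Since \<open>arcsin\<close> is not differentiable at the endpoints of its domain, the case \<open>\<bar>u\<bar> = 1\<close> is reached
  from \<open>c * u\<close> and \<open>c * v\<close> by letting \<open>c\<close> increase to \<open>1\<close>.
\<close>

lemma oscillation_bound:
  fixes u v :: "real \<Rightarrow> real"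
  assumes "x \<le> y"
    and u: "\<And>t. t \<in> {x..y} \<Longrightarrow> (u has_real_derivative v t) (at t)"
    and v: "\<And>t. t \<in> {x..y} \<Longrightarrow> (v has_real_derivative - u t) (at t)"
    and b: "\<And>t. t \<in> {x..y} \<Longrightarrow> \<bar>u t\<bar> \<le> 1"
  shows "\<bar>disc_area (u y) - disc_area (u x)\<bar> \<le> y - x + u y * v y - u x * v x"
proof -
  define Z where "Z c = y - x + c\<^sup>2 * (u y * v y - u x * v x)
      - \<bar>disc_area (c * u y) - disc_area (c * u x)\<bar>" for c :: real
  have comp: "continuous_on {0..1} (\<lambda>c. disc_area (c * u t))" if "t \<in> {x..y}" for t
  proof (rule continuous_on_compose2[OF continuous_on_disc_area])
    show "(\<lambda>c. c * u t) ` {0..1} \<subseteq> {-1..1}"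
    proof clarify
      fix c :: real assume "c \<in> {0..1}"
      then have "\<bar>c * u t\<bar> \<le> 1 * 1"
        unfolding abs_mult using b[OF that] by (intro mult_mono) auto
      then show "c * u t \<in> {-1..1}" by (simp add: abs_le_iff)
    qed
  qed (intro continuous_intros)
  have ends: "continuous_on {0..1} (\<lambda>c. disc_area (c * u y))" "continuous_on {0..1} (\<lambda>c. disc_area (c * u x))"
    using \<open>x \<le> y\<close> by (simp_all add: comp)
  have cl: "closure {0..<1::real} = {0..1}" by simp
  have Zc: "continuous_on (closure {0..<1}) Z"
    unfolding Z_def cl
    by (intro continuous_on_diff continuous_on_add continuous_on_mult continuous_on_rabs
          continuous_on_power continuous_on_const continuous_on_id ends)
  have Zn: "Z c \<ge> 0" if c: "c \<in> {0..<1}" for c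
  proof -
    have "\<bar>disc_area (c * u y) - disc_area (c * u x)\<bar> \<le> y - x + (c * u y) * (c * v y) - (c * u x) * (c * v x)"
    proof (rule oscillation_bound_strict[OF \<open>x \<le> y\<close>])
      fix t assume t: "t \<in> {x..y}"
      show "((\<lambda>t. c * u t) has_real_derivative c * v t) (at t)"
        by (intro DERIV_cmult u t)
      show "((\<lambda>t. c * v t) has_real_derivative - (c * u t)) (at t)"
        using DERIV_cmult[OF v[OF t], of c] by simp
      have "\<bar>c * u t\<bar> \<le> c * 1"
        unfolding abs_mult using b[OF t] c by (intro mult_mono) auto
      then show "\<bar>c * u t\<bar> < 1" using c by auto
    qed
    moreover have "(c * u y) * (c * v y) - (c * u x) * (c * v x) = c\<^sup>2 * (u y * v y - u x * v x)"
      by (simp add: power2_eq_square algebra_simps)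
    ultimately show ?thesis unfolding Z_def by linarith
  qed
  have "Z 1 \<ge> 0"
    by (rule continuous_ge_on_closure[OF Zc _ Zn]) (simp_all add: cl)
  then show ?thesis by (simp add: Z_def)
qed

section \<open>Waves on a single edge\<close>

text \<open>
  An edge is replaced by the interval \<open>[0, k]\<close>, carrying the solution of \<open>u'' = - u\<close> with the boundary
  values \<open>a\<close> and \<open>b\<close>. For \<open>0 < k < pi\<close> such a solution exists, is unique, and changes sign at most once.
\<close>

definition wave :: "real \<Rightarrow> real \<Rightarrow> real \<Rightarrow> real \<Rightarrow> real" where
  "wave k a b t = (a * sin (k - t) + b * sin t) / sin k"

definition wave' :: "real \<Rightarrow> real \<Rightarrow> real \<Rightarrow> real \<Rightarrow> real" where
  "wave' k a b t = (b * cos t - a * cos (k - t)) / sin k"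

lemma wave_deriv:
  "(wave k a b has_real_derivative wave' k a b t) (at t)"
  "(wave' k a b has_real_derivative - wave k a b t) (at t)"
proof -
  have "((\<lambda>t. a * sin (k - t) + b * sin t) has_real_derivative b * cos t - a * cos (k - t)) (at t)"
    by (auto intro!: derivative_eq_intros)
  then show "(wave k a b has_real_derivative wave' k a b t) (at t)"
    unfolding wave_def wave'_def by (rule DERIV_cdivide)
  have "((\<lambda>t. b * cos t - a * cos (k - t)) has_real_derivative - (a * sin (k - t) + b * sin t)) (at t)"
    by (auto intro!: derivative_eq_intros)
  then show "(wave' k a b has_real_derivative - wave k a b t) (at t)"
    unfolding wave_def wave'_def minus_divide_left by (rule DERIV_cdivide)
qed

lemma wave_ends:
  assumes "0 < k" "k < pi"
  shows "wave k a b 0 = a" "wave k a b k = b"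
  using sin_gt_zero[OF assms] by (auto simp: wave_def)

lemma wave_minus: "wave k (- a) (- b) t = - wave k a b t"
  by (simp add: wave_def diff_divide_distrib add_divide_distrib)

lemma continuous_on_wave: "continuous_on S (wave k a b)"
  by (rule DERIV_continuous_on) (rule wave_deriv(1)[THEN has_field_derivative_at_within])

lemma wave_nonneg:
  assumes "0 < k" "k < pi" "t \<in> {0..k}" "a \<ge> 0" "b \<ge> 0"
  shows "wave k a b t \<ge> 0"
  unfolding wave_def using assms
  by (intro divide_nonneg_nonneg add_nonneg_nonneg mult_nonneg_nonneg sin_ge_zero) auto

text \<open>
  A wave lies below the symmetric wave with both end values \<open>m\<close>, whose maximum, at the midpoint, is
  \<open>m / cos (k / 2)\<close>. This controls how far a maximum inside an edge can exceed the vertex values.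
\<close>

lemma wave_le_vertex_max:
  assumes k: "0 < k" "k < pi" and t: "t \<in> {0..k}" and m: "a \<le> m" "b \<le> m" "0 \<le> m"
  shows "wave k a b t * cos (k / 2) \<le> m"
proof -
  have s: "sin (k / 2) > 0" "cos (k / 2) > 0" "sin k = 2 * sin (k / 2) * cos (k / 2)"
    using k sin_gt_zero[of "k/2"] cos_gt_zero_pi[of "k/2"] sin_double[of "k/2"] by auto
  have "a * sin (k - t) + b * sin t \<le> m * sin (k - t) + m * sin t"
    using k t m by (intro add_mono mult_right_mono sin_ge_zero) auto
  also have "\<dots> = m * (2 * sin (k / 2) * cos (k / 2 - t))"
  proof -
    have "sin (k - t) + sin t = 2 * sin (k / 2) * cos (k / 2 - t)"
      using sin_plus_sin[of "k - t" t] by (simp add: diff_divide_distrib)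
    then show ?thesis by (simp flip: distrib_left)
  qed
  also have "\<dots> \<le> m * (2 * sin (k / 2) * 1)"
    using m s by (intro mult_left_mono) auto
  finally have "(a * sin (k - t) + b * sin t) * cos (k / 2) \<le> m * (2 * sin (k / 2) * 1) * cos (k / 2)"
    using s by (intro mult_right_mono) auto
  then have "(a * sin (k - t) + b * sin t) * cos (k / 2) \<le> m * sin k"
    by (simp add: s(3))
  then show ?thesis
    using s k sin_gt_zero[of k] by (simp add: wave_def pos_divide_le_eq)
qed

text \<open>
  The integral of \<open>u'\<^sup>2 - u\<^sup>2\<close> over the part of the edge where the wave \<open>u\<close> is positive. By partial
  integration it is a boundary term \<open>u * u'\<close>, in which the zeros of \<open>u\<close> do not contribute.
\<close>

definition pos_flux :: "real \<Rightarrow> real \<Rightarrow> real \<Rightarrow> real" where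
  "pos_flux k a b = - (max a 0 * (b - a * cos k) + max b 0 * (a - b * cos k)) / sin k"

definition pos_level :: "real \<Rightarrow> real \<Rightarrow> real" where
  "pos_level A t = disc_area (max t 0 / A)"

text \<open>
  Read \<open>p\<close> as the length of the set where the wave \<open>u\<close> is positive. The left hand side of the inequality is
  the rise of \<open>disc_area (max u 0 / A)\<close> from one end of the edge to the point \<open>t\<close>, plus its fall from there
  to the other end. With \<open>t\<close> at an end it bounds the difference of the two end values, and with \<open>t\<close> at
  the maximum it measures the whole excursion.
\<close>

definition controls_pos_part :: "real \<Rightarrow> real \<Rightarrow> real \<Rightarrow> real \<Rightarrow> bool" where
  "controls_pos_part p k a b \<longleftrightarrow>
     (\<forall>A>0. (\<forall>t\<in>{0..k}. wave k a b t \<le> A) \<longrightarrow>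
        (\<forall>t\<in>{0..k}. 2 * pos_level A (wave k a b t) - pos_level A a - pos_level A b
            \<le> p + pos_flux k a b / A\<^sup>2))"

lemma pos_level_nonpos: "t \<le> 0 \<Longrightarrow> pos_level A t = 0"
  by (simp add: pos_level_def max_def)

lemma pos_level_nonneg: "0 < A \<Longrightarrow> t \<le> A \<Longrightarrow> 0 \<le> pos_level A t"
  using disc_area_mono[of 0 "max t 0 / A"] by (simp add: pos_level_def)

text \<open>
  On the nonnegative arc \<open>[x, y]\<close>, scaled to height at most \<open>1\<close>, the oscillation bound applies on both sides
  of the point \<open>t\<close>, and the two boundary terms at \<open>t\<close> cancel.
\<close>

lemma controls_pos_part_interval:
  assumes k: "0 < k" "k < pi" and xy: "0 \<le> x" "x \<le> y" "y \<le> k"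
    and ends: "x = 0 \<or> wave k a b x = 0" "y = k \<or> wave k a b y = 0"
    and pos: "\<And>t. t \<in> {x..y} \<Longrightarrow> wave k a b t \<ge> 0"
    and neg: "\<And>t. t \<in> {0..k} - {x..y} \<Longrightarrow> wave k a b t \<le> 0"
  shows "controls_pos_part (y - x) k a b"
  unfolding controls_pos_part_def
proof (intro allI impI ballI)
  fix A t :: real
  assume A: "0 < A" "\<forall>t\<in>{0..k}. wave k a b t \<le> A" and t: "t \<in> {0..k}"
  let ?u = "\<lambda>t. wave k a b t / A" and ?v = "\<lambda>t. wave' k a b t / A"
  let ?F = "\<lambda>t. ?u t * ?v t"
  have arc: "\<bar>disc_area (?u q) - disc_area (?u p)\<bar> \<le> q - p + ?F q - ?F p"
    if "x \<le> p" "p \<le> q" "q \<le> y" for p q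
  proof (rule oscillation_bound[OF \<open>p \<le> q\<close>])
    fix s assume s: "s \<in> {p..q}"
    show "(?u has_real_derivative ?v s) (at s)"
      by (intro DERIV_cdivide wave_deriv)
    show "(?v has_real_derivative - ?u s) (at s)"
      using DERIV_cdivide[OF wave_deriv(2)[of k a b s], of A] by simp
    show "\<bar>?u s\<bar> \<le> 1" using pos[of s] A s that xy by auto
  qed
  have w: "wave k a b 0 = a" "wave k a b k = b" by (rule wave_ends[OF k])+
  have w': "wave' k a b 0 = (b - a * cos k) / sin k" "wave' k a b k = (b * cos k - a) / sin k"
    by (simp_all add: wave'_def)
  \<comment> \<open>At a zero of the wave inside the edge the flux vanishes, and the end beyond it is nonpositive.\<close>
  have X: "pos_level A a = disc_area (?u x) \<and> max a 0 * (b - a * cos k) / sin k = wave k a b x * wave' k a b x"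
  proof (cases "x = 0")
    case True
    then show ?thesis using pos[of 0] xy w w' by (simp add: pos_level_def max_def)
  next
    case False
    then have "wave k a b x = 0" "a \<le> 0" using ends neg[of 0] xy w by auto
    then show ?thesis by (simp add: pos_level_def max_def)
  qed
  have Y: "pos_level A b = disc_area (?u y) \<and> - (max b 0 * (a - b * cos k)) / sin k = wave k a b y * wave' k a b y"
  proof (cases "y = k")
    case True
    then show ?thesis using pos[of k] xy w w'
      by (simp add: pos_level_def max_def algebra_simps minus_divide_left)
  next
    case False
    then have "wave k a b y = 0" "b \<le> 0" using ends neg[of k] xy w k by auto
    then show ?thesis by (simp add: pos_level_def max_def)
  qed
  have J: "pos_flux k a b / A\<^sup>2 = ?F y - ?F x"
  proof -
    have "pos_flux k a b = wave k a b y * wave' k a b y - wave k a b x * wave' k a b x"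
      using X Y by (simp add: pos_flux_def add_divide_distrib diff_divide_distrib)
    then show ?thesis by (simp add: power2_eq_square diff_divide_distrib)
  qed
  show "2 * pos_level A (wave k a b t) - pos_level A a - pos_level A b
      \<le> y - x + pos_flux k a b / A\<^sup>2"
  proof (cases "t \<in> {x..y}")
    case True
    then have "pos_level A (wave k a b t) = disc_area (?u t)"
      using pos[OF True] by (simp add: pos_level_def max_def)
    moreover have "disc_area (?u t) - disc_area (?u x) \<le> t - x + ?F t - ?F x"
      "disc_area (?u t) - disc_area (?u y) \<le> y - t + ?F y - ?F t"
      using arc[of x t] arc[of t y] True by auto
    ultimately show ?thesis using X Y J by linarith
  next
    case False
    have "pos_level A a \<ge> 0" "pos_level A b \<ge> 0"
      using A(1) A(2)[rule_format, of 0] A(2)[rule_format, of k] w k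
      by (auto intro!: pos_level_nonneg)
    moreover have "0 \<le> y - x + ?F y - ?F x"
      using arc[of x y] xy by auto
    ultimately show ?thesis using neg[of t] False t J pos_level_nonpos[of "wave k a b t" A] by auto
  qed
qed

text \<open>
  Because a wave has at most one sign change on an interval of length less than \<open>pi\<close>, its zero cuts the
  edge into a positive and a negative part. The latter is the positive part of the negated wave.
\<close>

lemma nodal_split_exists:
  assumes k: "0 < k" "k < pi"
  shows "\<exists>p n. p + n \<le> k \<and> controls_pos_part p k a b \<and> controls_pos_part n k (- a) (- b)"
proof -
  have triv: "controls_pos_part 0 k a b" if ab: "a \<le> 0" "b \<le> 0" for a b
  proof -
    have "wave k a b t \<le> 0" if "t \<in> {0..k}" for t
      using wave_nonneg[OF k that, of "-a" "-b"] ab by (simp add: wave_minus)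
    then show ?thesis
      using ab by (simp add: controls_pos_part_def pos_level_nonpos pos_flux_def max_def)
  qed
  have main: "\<exists>p n. p + n \<le> k \<and> controls_pos_part p k a b \<and> controls_pos_part n k (- a) (- b)"
    if a: "a \<ge> 0" for a b
  proof (cases "b \<ge> 0")
    case True
    have "controls_pos_part (k - 0) k a b"
      by (rule controls_pos_part_interval[OF k]) (use k a True wave_nonneg[OF k] in auto)
    then show ?thesis
      using triv[of "-a" "-b"] a True by (intro exI[of _ k] exI[of _ 0]) auto
  next
    case False
    obtain c where c: "c \<in> {0..k}" "wave k a b c = 0"
    proof -
      have "\<exists>c\<ge>0. c \<le> k \<and> wave k a b c = 0"
        by (rule IVT2') (use wave_ends[OF k] a False k continuous_on_wave in auto)
      then show ?thesis using that by auto
    qed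
    have "c \<noteq> k" using c(2) wave_ends[OF k] False by auto
    then have sc: "sin (k - c) > 0" using c(1) k by (intro sin_gt_zero) auto
    have sk: "sin k > 0" using k by (rule sin_gt_zero)
    \<comment> \<open>A wave that vanishes at \<open>c\<close> is a multiple of \<open>sin (t - c)\<close>, which makes its signs visible. The value
      at the end \<open>k\<close> serves to normalise it, because \<open>a\<close> and \<open>c\<close> may both be \<open>0\<close>.\<close>
    have w: "wave k a b t * sin (k - c) = b * sin (t - c)" for t
    proof -
      have e: "a * sin (k - c) = - b * sin c" using c(2) sk by (simp add: wave_def)
      have "wave k a b t * sin (k - c) * sin k
          = (a * sin (k - c)) * sin (k - t) + b * sin t * sin (k - c)"
        using sk by (simp add: wave_def field_simps)
      also have "\<dots> = b * (sin t * sin (k - c) - sin c * sin (k - t))"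
        unfolding e by (simp add: algebra_simps)
      also have "sin t * sin (k - c) - sin c * sin (k - t) = sin k * sin (t - c)"
        by (simp add: sin_diff algebra_simps)
      finally show ?thesis using sk by simp
    qed
    have pos: "wave k a b t \<ge> 0" if "t \<in> {0..c}" for t
    proof -
      have "sin (c - t) \<ge> 0" using that c(1) k by (intro sin_ge_zero) auto
      then have "sin (t - c) \<le> 0" using sin_minus[of "c - t"] by simp
      then have "wave k a b t * sin (k - c) \<ge> 0"
        unfolding w using False by (intro mult_nonpos_nonpos) auto
      then show ?thesis using sc by (simp add: zero_le_mult_iff)
    qed
    have neg: "wave k a b t \<le> 0" if "t \<in> {c..k}" for t
    proof -
      have "sin (t - c) \<ge> 0" using that c(1) k by (intro sin_ge_zero) auto
      then have "wave k a b t * sin (k - c) \<le> 0"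
        unfolding w using False by (intro mult_nonpos_nonneg) auto
      then show ?thesis using sc by (simp add: mult_le_0_iff)
    qed
    have "controls_pos_part (c - 0) k a b"
      by (rule controls_pos_part_interval[OF k]) (use c pos neg in auto)
    moreover have "controls_pos_part (k - c) k (- a) (- b)"
      by (rule controls_pos_part_interval[OF k]) (use c pos neg in \<open>auto simp: wave_minus\<close>)
    ultimately show ?thesis by (intro exI[of _ c] exI[of _ "k - c"]) auto
  qed
  show ?thesis
  proof (cases "a \<ge> 0")
    case True
    then show ?thesis by (rule main)
  next
    case False
    then obtain p n where "p + n \<le> k" "controls_pos_part p k (- a) (- b)" "controls_pos_part n k a b"
      using main[of "-a" "-b"] by auto
    then show ?thesis by (intro exI[of _ n] exI[of _ p]) auto
  qed
qed

text \<open>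
  The first-order condition for a minimum at \<open>t = 0\<close>, as needed for the variation of a Rayleigh quotient.
\<close>

lemma quadratic_nonneg_imp_zero_slope:
  fixes b c :: real
  assumes "\<And>t. 0 \<le> 2 * t * b + t\<^sup>2 * c"
  shows "b = 0"
proof (rule ccontr)
  assume b: "b \<noteq> 0"
  define s where "s = \<bar>c\<bar> + 1"
  have s: "s > 0" "c < s" by (auto simp: s_def)
  \<comment> \<open>At \<open>t = - b / s\<close> the linear term dominates the quadratic one, because \<open>s > c\<close>.\<close>
  have "(2 * (- b / s) * b + (- b / s)\<^sup>2 * c) * s\<^sup>2 = b\<^sup>2 * (c - 2 * s)"
    using s by (simp add: power2_eq_square field_simps)
  moreover have "0 \<le> (2 * (- b / s) * b + (- b / s)\<^sup>2 * c) * s\<^sup>2"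
    by (intro mult_nonneg_nonneg assms) simp
  moreover have "b\<^sup>2 * (c - 2 * s) < 0"
    using b s by (intro mult_pos_neg) auto
  ultimately show False by linarith
qed

section \<open>Cuts and edge connectivity\<close>

locale connected_multigraph = fin_digraph G + loopfree_digraph G
  for G :: "('a, 'b) pre_digraph" (structure) +
  assumes conn: "Digraph_Component.connected G"
    and two_verts: "card (verts G) \<ge> 2"
begin

definition cut :: "'a set \<Rightarrow> 'b set" where
  "cut S = {e \<in> arcs G. (tail G e \<in> S) \<noteq> (head G e \<in> S)}"

text \<open>
  A path that starts in \<open>S\<close> and avoids the arcs of the cut never leaves \<open>S\<close>.
\<close>

lemma cut_disconnects:
  assumes S: "S \<subseteq> verts G" "S \<noteq> {}" "S \<noteq> verts G"
  shows "\<not> Digraph_Component.connected (delete_arcs G (cut S))"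
proof
  assume "Digraph_Component.connected (delete_arcs G (cut S))"
  moreover obtain u w where u: "u \<in> S" and w: "w \<in> verts G" "w \<notin> S" using S by auto
  ultimately have "(u, w) \<in> rtrancl_on (verts G) ((arcs_ends (delete_arcs G (cut S)))\<^sup>s)"
    using S by (auto simp: connected_conv delete_arcs_def)
  then have "w \<in> S"
  proof (induction rule: rtrancl_on_induct)
    case base
    show ?case by (rule u)
  next
    case (step y z)
    then show ?case
      by (auto simp: symcl_def arcs_ends_conv delete_arcs_def cut_def)
  qed
  then show False using w by simp
qed

lemma edge_connectivity_le_cut:
  assumes "S \<subseteq> verts G" "S \<noteq> {}" "S \<noteq> verts G"
  shows "edge_connectivity G \<le> card (cut S)"
  unfolding edge_connectivity_def
  using cut_disconnects[OF assms] by (intro Least_le exI[of _ "cut S"]) (auto simp: cut_def)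

lemma singleton_proper: "v \<in> verts G \<Longrightarrow> {v} \<noteq> verts G"
  using two_verts by (metis card_1_singleton_iff One_nat_def not_less_eq_eq numeral_2_eq_2 order_refl)

lemma ends_distinct:
  "e \<in> arcs G \<Longrightarrow> tail G e \<noteq> head G e" "e \<in> arcs G \<Longrightarrow> head G e \<noteq> tail G e"
  using no_loops by (auto dest: sym)

text \<open>
  A set of arcs whose removal disconnects \<open>G\<close> exists, for instance the cut around a single vertex, and it is
  nonempty as \<open>G\<close> itself is connected.
\<close>

lemma edge_connectivity_pos: "edge_connectivity G > 0"
proof -
  obtain v where v: "v \<in> verts G" using two_verts by fastforce
  let ?P = "\<lambda>k. \<exists>F \<subseteq> arcs G. card F = k \<and> \<not> Digraph_Component.connected (delete_arcs G F)"
  have "?P (card (cut {v}))"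
    using cut_disconnects[of "{v}"] v singleton_proper by (intro exI[of _ "cut {v}"]) (auto simp: cut_def)
  then have "?P (edge_connectivity G)" unfolding edge_connectivity_def by (rule LeastI)
  then obtain F where F: "F \<subseteq> arcs G" "card F = edge_connectivity G"
      "\<not> Digraph_Component.connected (delete_arcs G F)" by blast
  have "F \<noteq> {}" using F(3) conn by (auto simp: delete_arcs_def)
  then show ?thesis using F finite_subset[OF F(1)] by (metis card_gt_0_iff finite_arcs)
qed

lemma degree_pos:
  assumes v: "v \<in> verts G"
  shows "undirected_degree G v > 0"
proof -
  have "0 < card (cut {v})"
    using edge_connectivity_le_cut[of "{v}"] edge_connectivity_pos v singleton_proper by simp
  also have "\<dots> \<le> undirected_degree G v"
    unfolding undirected_degree_def cut_def by (rule card_mono) auto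
  finally show ?thesis .
qed

lemma ex_incident_arc:
  assumes "v \<in> verts G"
  obtains e where "e \<in> arcs G" "tail G e = v \<or> head G e = v"
  using degree_pos[OF assms] by (auto simp: undirected_degree_def card_gt_0_iff)

text \<open>
  The total variation of \<open>h\<close> along the edges is the integral over all levels of the number of edges that cross
  the level, and these edges form a cut if the level lies strictly between two values of \<open>h\<close>. The induction
  realises this by removing the smallest value of \<open>h\<close>: raising it to the second smallest value \<open>m'\<close> reduces
  the variation by \<open>m' - m\<close> for each edge of the cut between the minimum set and the rest.
\<close>

lemma cut_coarea:
  fixes h :: "'a \<Rightarrow> real"
  assumes "u \<in> verts G" "w \<in> verts G"
  shows "real (edge_connectivity G) * (h u - h w) \<le> (\<Sum>e\<in>arcs G. \<bar>h (tail G e) - h (head G e)\<bar>)"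
proof (induction "card (h ` verts G)" arbitrary: h rule: less_induct)
  case less
  let ?\<eta> = "real (edge_connectivity G)"
  let ?m = "Min (h ` verts G)"
  have fin: "finite (h ` verts G)" and ne: "h ` verts G \<noteq> {}" using assms by auto
  have m: "?m \<le> h v" if "v \<in> verts G" for v using that fin by auto
  show ?case
  proof (cases "h u \<le> h w")
    case True
    then have "?\<eta> * (h u - h w) \<le> 0" by (intro mult_nonneg_nonpos) auto
    also have "0 \<le> (\<Sum>e\<in>arcs G. \<bar>h (tail G e) - h (head G e)\<bar>)" by (rule sum_nonneg) simp
    finally show ?thesis .
  next
    case False
    then have hu: "?m < h u" using m[OF assms(2)] by simp
    define T where "T = h ` verts G - {?m}"
    define m' where "m' = Min T"
    define h' where "h' v = max (h v) m'" for v
    define S where "S = {v \<in> verts G. h v \<noteq> ?m}"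
    have T: "finite T" "T \<noteq> {}" using fin hu assms by (auto simp: T_def)
    have mT: "m' \<in> T" unfolding m'_def using T by (rule Min_in)
    have "?m < m'" using mT fin unfolding T_def by (metis DiffD1 DiffD2 Min_le insertI1 order_le_less)
    have low: "h v = ?m \<or> m' \<le> h v" if "v \<in> verts G" for v
    proof (cases "h v = ?m")
      case False
      then have "h v \<in> T" using that by (simp add: T_def)
      then show ?thesis using T(1) by (simp add: m'_def)
    qed simp
    have img: "h' ` verts G \<subseteq> T"
    proof
      fix x assume "x \<in> h' ` verts G"
      then obtain v where v: "v \<in> verts G" "x = max (h v) m'" by (auto simp: h'_def)
      show "x \<in> T"
      proof (cases "h v = ?m")
        case True
        then show ?thesis using v \<open>?m < m'\<close> mT by (simp add: max_def)
      next
        case False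
        then show ?thesis using v low[OF v(1)] by (auto simp: T_def max_def)
      qed
    qed
    have "card (h' ` verts G) \<le> card T" using T img by (intro card_mono)
    also have "\<dots> < card (h ` verts G)" unfolding T_def using fin ne by (intro card_Diff1_less Min_in)
    finally have IH: "?\<eta> * (h' u - h' w) \<le> (\<Sum>e\<in>arcs G. \<bar>h' (tail G e) - h' (head G e)\<bar>)"
      by (rule less.hyps)
    have "?m \<in> h ` verts G" using fin ne by (rule Min_in)
    then have "S \<noteq> verts G" by (auto simp: S_def)
    moreover have "S \<noteq> {}" "S \<subseteq> verts G" using assms hu by (auto simp: S_def)
    ultimately have "?\<eta> \<le> card (cut S)" using edge_connectivity_le_cut by simp
    then have "?\<eta> * (m' - ?m) \<le> real (card (cut S)) * (m' - ?m)"
      using \<open>?m < m'\<close> by (intro mult_right_mono) auto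
    also have "\<dots> = (\<Sum>e\<in>arcs G. if (tail G e \<in> S) \<noteq> (head G e \<in> S) then m' - ?m else 0)"
      by (simp add: cut_def sum.If_cases Int_def flip: sum.inter_filter)
    finally have "?\<eta> * (h' u - h' w) + ?\<eta> * (m' - ?m)
        \<le> (\<Sum>e\<in>arcs G. \<bar>h' (tail G e) - h' (head G e)\<bar> +
              (if (tail G e \<in> S) \<noteq> (head G e \<in> S) then m' - ?m else 0))"
      using IH by (simp add: sum.distrib)
    also have "\<dots> = (\<Sum>e\<in>arcs G. \<bar>h (tail G e) - h (head G e)\<bar>)"
    proof (rule sum.cong[OF refl])
      fix e assume "e \<in> arcs G"
      then have "tail G e \<in> verts G" "head G e \<in> verts G" by auto
      then show "\<bar>h' (tail G e) - h' (head G e)\<bar> +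
              (if (tail G e \<in> S) \<noteq> (head G e \<in> S) then m' - ?m else 0) = \<bar>h (tail G e) - h (head G e)\<bar>"
        using low[of "tail G e"] low[of "head G e"] \<open>?m < m'\<close>
        by (auto simp: h'_def S_def max_def)
    qed
    finally have "?\<eta> * (h' u - h' w + (m' - ?m)) \<le> (\<Sum>e\<in>arcs G. \<bar>h (tail G e) - h (head G e)\<bar>)"
      by (simp add: distrib_left)
    moreover have "h u - h w \<le> h' u - h' w + (m' - ?m)"
      using low[OF assms(1)] low[OF assms(2)] hu \<open>?m < m'\<close> by (auto simp: h'_def max_def)
    then have "?\<eta> * (h u - h w) \<le> ?\<eta> * (h' u - h' w + (m' - ?m))"
      by (intro mult_left_mono) auto
    ultimately show ?thesis by linarith
  qed
qed

section \<open>The weak form of the eigenvalue equation\<close>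

definition dirichlet :: "('a \<Rightarrow> real) \<Rightarrow> ('a \<Rightarrow> real) \<Rightarrow> real" where
  "dirichlet f g = (\<Sum>e\<in>arcs G. (f (tail G e) - f (head G e)) * (g (tail G e) - g (head G e)))"

definition deg_inner :: "('a \<Rightarrow> real) \<Rightarrow> ('a \<Rightarrow> real) \<Rightarrow> real" where
  "deg_inner f g = (\<Sum>v\<in>verts G. f v * g v * real (undirected_degree G v))"

lemma degree_conv_sum:
  "real (undirected_degree G v) = (\<Sum>e\<in>arcs G. of_bool (tail G e = v) + of_bool (head G e = v))"
proof -
  have "real (undirected_degree G v) = (\<Sum>e\<in>arcs G. if tail G e = v \<or> head G e = v then 1 else 0)"
    by (simp add: undirected_degree_def flip: sum.inter_filter)
  also have "\<dots> = (\<Sum>e\<in>arcs G. of_bool (tail G e = v) + of_bool (head G e = v))"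
    by (intro sum.cong) (auto simp: ends_distinct)
  finally show ?thesis .
qed

lemma deg_inner_conv_arcs:
  "deg_inner f g = (\<Sum>e\<in>arcs G. f (tail G e) * g (tail G e) + f (head G e) * g (head G e))"
proof -
  have "deg_inner f g = (\<Sum>v\<in>verts G. \<Sum>e\<in>arcs G.
      (if tail G e = v then f v * g v else 0) + (if head G e = v then f v * g v else 0))"
    unfolding deg_inner_def degree_conv_sum sum_distrib_left
    by (intro sum.cong refl) (auto simp: of_bool_def)
  also have "\<dots> = (\<Sum>e\<in>arcs G. \<Sum>v\<in>verts G.
      (if tail G e = v then f v * g v else 0) + (if head G e = v then f v * g v else 0))"
    by (rule sum.swap)
  also have "\<dots> = (\<Sum>e\<in>arcs G. f (tail G e) * g (tail G e) + f (head G e) * g (head G e))"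
    by (intro sum.cong refl) (simp add: sum.distrib)
  finally show ?thesis .
qed

lemma deg_inner_pos:
  assumes "v \<in> verts G" "f v \<noteq> 0"
  shows "deg_inner f f > 0"
  unfolding deg_inner_def
  by (rule sum_pos2[of _ v]) (use assms degree_pos[of v] in \<open>auto simp: zero_less_mult_iff linorder_neq_iff\<close>)

lemma laplacian_sum:
  assumes u: "u \<in> verts G"
  shows "(\<Sum>v\<in>verts G. laplacian G u v * f v) =
    (\<Sum>e\<in>arcs G. (f (tail G e) - f (head G e)) * (of_bool (tail G e = u) - of_bool (head G e = u)))"
proof -
  have adj: "(\<Sum>v\<in>verts G. real (adjacency G u v) * f v) =
      (\<Sum>e\<in>arcs G. of_bool (tail G e = u) * f (head G e) + of_bool (head G e = u) * f (tail G e))"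
  proof -
    have "(\<Sum>v\<in>verts G. real (adjacency G u v) * f v) =
        (\<Sum>v\<in>verts G. \<Sum>e\<in>arcs G. (if head G e = v then of_bool (tail G e = u) * f v else 0)
            + (if tail G e = v then of_bool (head G e = u) * f v else 0))"
    proof (rule sum.cong[OF refl])
      fix v
      have "real (adjacency G u v) * f v = (\<Sum>e\<in>arcs G. if {tail G e, head G e} = {u, v} then f v else 0)"
        by (simp add: adjacency_def flip: sum.inter_filter)
      also have "\<dots> = (\<Sum>e\<in>arcs G. (if head G e = v then of_bool (tail G e = u) * f v else 0)
            + (if tail G e = v then of_bool (head G e = u) * f v else 0))"
        by (intro sum.cong refl) (auto simp: doubleton_eq_iff ends_distinct)
      finally show "real (adjacency G u v) * f v = \<dots>" .
    qed
    also have "\<dots> = (\<Sum>e\<in>arcs G. \<Sum>v\<in>verts G. (if head G e = v then of_bool (tail G e = u) * f v else 0)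
            + (if tail G e = v then of_bool (head G e = u) * f v else 0))"
      by (rule sum.swap)
    also have "\<dots> = (\<Sum>e\<in>arcs G. of_bool (tail G e = u) * f (head G e) + of_bool (head G e = u) * f (tail G e))"
      by (intro sum.cong refl) (simp add: sum.distrib)
    finally show ?thesis .
  qed
  have "(\<Sum>v\<in>verts G. laplacian G u v * f v) =
      (\<Sum>v\<in>verts G. (if u = v then real (undirected_degree G u) * f v else 0)
         - real (adjacency G u v) * f v)"
    by (intro sum.cong refl) (simp add: laplacian_def left_diff_distrib)
  also have "\<dots> = real (undirected_degree G u) * f u - (\<Sum>v\<in>verts G. real (adjacency G u v) * f v)"
    using u by (simp add: sum_subtractf)
  also have "\<dots> = (\<Sum>e\<in>arcs G. (of_bool (tail G e = u) + of_bool (head G e = u)) * f u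
      - (of_bool (tail G e = u) * f (head G e) + of_bool (head G e = u) * f (tail G e)))"
    unfolding adj degree_conv_sum sum_distrib_right by (simp add: sum_subtractf)
  also have "\<dots> = (\<Sum>e\<in>arcs G. (f (tail G e) - f (head G e)) * (of_bool (tail G e = u) - of_bool (head G e = u)))"
    by (intro sum.cong refl) (auto simp: ends_distinct)
  finally show ?thesis .
qed

text \<open>
  Testing against indicator functions of vertices recovers the pointwise equation from the weak one.
\<close>

lemma weak_eigen_iff:
  "(\<forall>u\<in>verts G. (\<Sum>v\<in>verts G. laplacian G u v * f v) = l * real (undirected_degree G u) * f u)
     \<longleftrightarrow> (\<forall>g. dirichlet f g = l * deg_inner f g)"
proof
  assume L: "\<forall>u\<in>verts G. (\<Sum>v\<in>verts G. laplacian G u v * f v) = l * real (undirected_degree G u) * f u"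
  show "\<forall>g. dirichlet f g = l * deg_inner f g"
  proof
    fix g
    have "l * deg_inner f g = (\<Sum>u\<in>verts G. g u * (\<Sum>v\<in>verts G. laplacian G u v * f v))"
      unfolding deg_inner_def sum_distrib_left[of l] using L by (intro sum.cong refl) simp
    also have "\<dots> = (\<Sum>u\<in>verts G. \<Sum>e\<in>arcs G. (f (tail G e) - f (head G e)) *
        ((if tail G e = u then g u else 0) - (if head G e = u then g u else 0)))"
      by (intro sum.cong refl) (auto simp: laplacian_sum sum_distrib_left intro!: sum.cong)
    also have "\<dots> = (\<Sum>e\<in>arcs G. \<Sum>u\<in>verts G. (f (tail G e) - f (head G e)) *
        ((if tail G e = u then g u else 0) - (if head G e = u then g u else 0)))"
      by (rule sum.swap)
    also have "\<dots> = dirichlet f g"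
      unfolding dirichlet_def
      by (intro sum.cong refl) (simp add: sum_subtractf flip: sum_distrib_left)
    finally show "dirichlet f g = l * deg_inner f g" by simp
  qed
next
  assume W: "\<forall>g. dirichlet f g = l * deg_inner f g"
  show "\<forall>u\<in>verts G. (\<Sum>v\<in>verts G. laplacian G u v * f v) = l * real (undirected_degree G u) * f u"
  proof
    fix u assume u: "u \<in> verts G"
    have "(\<Sum>v\<in>verts G. laplacian G u v * f v) = dirichlet f (\<lambda>v. of_bool (v = u))"
      by (simp add: laplacian_sum[OF u] dirichlet_def)
    also have "\<dots> = l * deg_inner f (\<lambda>v. of_bool (v = u))" using W by simp
    also have "deg_inner f (\<lambda>v. of_bool (v = u)) = (\<Sum>v\<in>verts G. if v = u then f u * real (undirected_degree G u) else 0)"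
      unfolding deg_inner_def by (intro sum.cong) auto
    also have "\<dots> = f u * real (undirected_degree G u)" using u by simp
    finally show "(\<Sum>v\<in>verts G. laplacian G u v * f v) = l * real (undirected_degree G u) * f u" by simp
  qed
qed

text \<open>
  The substitution \<open>\<phi> v = sqrt (deg v) * f v\<close> turns the eigenvalue equation of the symmetric matrix
  \<open>D\<^sup>-\<^sup>1\<^sup>/\<^sup>2 (D - A) D\<^sup>-\<^sup>1\<^sup>/\<^sup>2\<close> into \<open>(D - A) f = l D f\<close>, which has the Dirichlet form as its weak formulation.
\<close>

lemma eigenvalue_iff:
  "l \<in> normalized_laplacian_eigenvalues G \<longleftrightarrow>
     (\<exists>f. (\<exists>v\<in>verts G. f v \<noteq> 0) \<and> (\<forall>g. dirichlet f g = l * deg_inner f g))"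
proof -
  let ?s = "\<lambda>v. sqrt (real (undirected_degree G v))"
  have s: "?s v > 0" if "v \<in> verts G" for v using degree_pos[OF that] by simp
  have conj: "(\<Sum>v\<in>verts G. normalized_laplacian G u v * (?s v * f v)) = l * (?s u * f u) \<longleftrightarrow>
      (\<Sum>v\<in>verts G. laplacian G u v * f v) = l * real (undirected_degree G u) * f u"
    if u: "u \<in> verts G" for u and f :: "'a \<Rightarrow> real"
  proof -
    have "(\<Sum>v\<in>verts G. normalized_laplacian G u v * (?s v * f v)) =
        (\<Sum>v\<in>verts G. laplacian G u v * f v) / ?s u"
      unfolding sum_divide_distrib
    proof (rule sum.cong[OF refl])
      fix v assume "v \<in> verts G"
      then show "normalized_laplacian G u v * (?s v * f v) = laplacian G u v * f v / ?s u"
        using s[of v] by (simp add: normalized_laplacian_def)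
    qed
    moreover have "X / ?s u = l * (?s u * f u) \<longleftrightarrow> X = l * real (undirected_degree G u) * f u" for X
    proof -
      have "X / ?s u = l * (?s u * f u) \<longleftrightarrow> X = l * (?s u * f u) * ?s u"
        using s[OF u] by (simp only: divide_eq_eq) simp
      also have "l * (?s u * f u) * ?s u = l * (?s u * ?s u) * f u" by (simp only: mult_ac)
      also have "?s u * ?s u = real (undirected_degree G u)" by simp
      finally show ?thesis .
    qed
    ultimately show ?thesis by simp
  qed
  show ?thesis
  proof
    assume "l \<in> normalized_laplacian_eigenvalues G"
    then obtain f where f: "\<exists>v\<in>verts G. f v \<noteq> 0"
      "\<And>u. u \<in> verts G \<Longrightarrow> (\<Sum>v\<in>verts G. normalized_laplacian G u v * f v) = l * f u"
      by (auto simp: normalized_laplacian_eigenvalues_def)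
    let ?f = "\<lambda>v. f v / ?s v"
    have "(\<Sum>v\<in>verts G. laplacian G u v * ?f v) = l * real (undirected_degree G u) * ?f u"
      if u: "u \<in> verts G" for u
    proof -
      have cancel: "?s v * ?f v = f v" if "v \<in> verts G" for v
        using s[OF that] by simp
      have "(\<Sum>v\<in>verts G. normalized_laplacian G u v * (?s v * ?f v)) =
          (\<Sum>v\<in>verts G. normalized_laplacian G u v * f v)"
        by (rule sum.cong[OF refl]) (simp only: cancel)
      also have "\<dots> = l * (?s u * ?f u)" using f(2)[OF u] by (simp only: cancel[OF u])
      finally show ?thesis using conj[OF u, of ?f] by (simp only:)
    qed
    then have "\<forall>g. dirichlet ?f g = l * deg_inner ?f g" using weak_eigen_iff[of ?f l] by blast
    moreover have "\<exists>v\<in>verts G. ?f v \<noteq> 0" using f(1) s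
      by (metis divide_eq_0_iff less_irrefl)
    ultimately show "\<exists>f. (\<exists>v\<in>verts G. f v \<noteq> 0) \<and> (\<forall>g. dirichlet f g = l * deg_inner f g)"
      by (intro exI[of _ ?f] conjI)
  next
    assume "\<exists>f. (\<exists>v\<in>verts G. f v \<noteq> 0) \<and> (\<forall>g. dirichlet f g = l * deg_inner f g)"
    then obtain f where f: "\<exists>v\<in>verts G. f v \<noteq> 0" "\<forall>g. dirichlet f g = l * deg_inner f g" by blast
    let ?f = "\<lambda>v. ?s v * f v"
    have "\<forall>u\<in>verts G. (\<Sum>v\<in>verts G. normalized_laplacian G u v * ?f v) = l * ?f u"
      using conj weak_eigen_iff[of f l] f(2) by blast
    moreover have "\<exists>v\<in>verts G. ?f v \<noteq> 0" using f(1) s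
      by (metis mult_eq_0_iff less_irrefl)
    ultimately show "l \<in> normalized_laplacian_eigenvalues G"
      unfolding normalized_laplacian_eigenvalues_def by (intro CollectI exI[of _ ?f] conjI)
  qed
qed

section \<open>The variational characterisation of the first nonzero eigenvalue\<close>

lemma deg_inner_one: "deg_inner f (\<lambda>_. 1) = (\<Sum>v\<in>verts G. f v * real (undirected_degree G v))"
  by (simp add: deg_inner_def)

lemma deg_inner_self: "deg_inner f f = (\<Sum>v\<in>verts G. \<bar>f v\<bar>\<^sup>2 * real (undirected_degree G v))"
  by (simp add: deg_inner_def power2_eq_square)

lemma dirichlet_self: "dirichlet f f = (\<Sum>e\<in>arcs G. \<bar>f (tail G e) - f (head G e)\<bar>\<^sup>2)"
  by (simp add: dirichlet_def power2_eq_square)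

lemma dirichlet_nonneg: "dirichlet f f \<ge> 0"
  unfolding dirichlet_self by (rule sum_nonneg) simp

lemma dirichlet_scale: "dirichlet (\<lambda>v. f v / c) (\<lambda>v. f v / c) = dirichlet f f / c\<^sup>2"
  unfolding dirichlet_self sum_divide_distrib
  by (simp add: power_divide flip: diff_divide_distrib)

lemma deg_inner_scale: "deg_inner (\<lambda>v. f v / c) (\<lambda>v. f v / c) = deg_inner f f / c\<^sup>2"
  unfolding deg_inner_self sum_divide_distrib by (simp add: power_divide)

lemma dirichlet_cong:
  "(\<And>v. v \<in> verts G \<Longrightarrow> f v = f' v) \<Longrightarrow> (\<And>v. v \<in> verts G \<Longrightarrow> g v = g' v) \<Longrightarrow>
    dirichlet f g = dirichlet f' g'"
  unfolding dirichlet_def by (intro sum.cong refl) simp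

lemma deg_inner_cong:
  "(\<And>v. v \<in> verts G \<Longrightarrow> f v = f' v) \<Longrightarrow> (\<And>v. v \<in> verts G \<Longrightarrow> g v = g' v) \<Longrightarrow>
    deg_inner f g = deg_inner f' g'"
  unfolding deg_inner_def by (intro sum.cong refl) simp

text \<open>
  The unit sphere of the space of functions that are orthogonal to the constants. Functions are required to
  vanish off the vertex set in order that the sphere be compact in the product topology.
\<close>

definition unit_sphere :: "('a \<Rightarrow> real) set" where
  "unit_sphere = {f. (\<forall>v. v \<notin> verts G \<longrightarrow> f v = 0) \<and> deg_inner f (\<lambda>_. 1) = 0 \<and> deg_inner f f = 1}"

text \<open>
  As all degrees are at least \<open>1\<close>, the sphere is a closed subset of a product of compact intervals, to which Tychonoff's theorem applies.
\<close>

lemma compact_unit_sphere: "compact unit_sphere"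
proof -
  let ?box = "Pi\<^sub>E UNIV (\<lambda>v. if v \<in> verts G then {-1..1::real} else {0})"
  have "compactin (product_topology (\<lambda>i::'a. euclidean :: real topology) UNIV) ?box"
    by (subst compactin_PiE) (auto simp: compactin_euclidean_iff)
  then have "compact ?box"
    by (simp add: euclidean_product_topology compactin_euclidean_iff)
  moreover have c: "continuous_on UNIV (\<lambda>f::'a \<Rightarrow> real. f v)" for v
    by (rule continuous_on_product_coordinates)
  have "closed {f. deg_inner f (\<lambda>_. 1) = 0}" "closed {f. deg_inner f f = 1}"
    unfolding deg_inner_def
    by (intro closed_Collect_eq continuous_on_sum continuous_on_mult continuous_on_const c)+
  ultimately have "compact (?box \<inter> ({f. deg_inner f (\<lambda>_. 1) = 0} \<inter> {f. deg_inner f f = 1}))"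
    by (intro compact_Int_closed closed_Int)
  also have "?box \<inter> ({f. deg_inner f (\<lambda>_. 1) = 0} \<inter> {f. deg_inner f f = 1}) = unit_sphere"
  proof (intro equalityI subsetI)
    fix f assume "f \<in> ?box \<inter> ({f. deg_inner f (\<lambda>_. 1) = 0} \<inter> {f. deg_inner f f = 1})"
    then show "f \<in> unit_sphere"
      by (auto simp: unit_sphere_def PiE_iff) (metis singletonD)
  next
    fix f assume f: "f \<in> unit_sphere"
    have "f v \<in> {-1..1}" if v: "v \<in> verts G" for v
    proof -
      have "(f v)\<^sup>2 * 1 \<le> (f v)\<^sup>2 * real (undirected_degree G v)"
        using degree_pos[OF v] by (intro mult_left_mono) auto
      also have "\<dots> \<le> deg_inner f f"
        unfolding deg_inner_def
        using member_le_sum[of v "verts G" "\<lambda>v. f v * f v * real (undirected_degree G v)"] v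
        by (simp add: power2_eq_square)
      also have "\<dots> = 1" using f by (simp add: unit_sphere_def)
      finally have "\<bar>f v\<bar> \<le> 1" by (simp add: abs_square_le_1)
      then show ?thesis by (simp add: abs_le_iff)
    qed
    then show "f \<in> ?box \<inter> ({f. deg_inner f (\<lambda>_. 1) = 0} \<inter> {f. deg_inner f f = 1})"
      using f by (auto simp: unit_sphere_def PiE_iff)
  qed
  finally show ?thesis .
qed

lemma normalize_to_unit_sphere:
  assumes nz: "\<exists>v\<in>verts G. f v \<noteq> 0" and mean: "deg_inner f (\<lambda>_. 1) = 0"
  obtains g where "g \<in> unit_sphere" "dirichlet g g = dirichlet f f / deg_inner f f"
proof -
  let ?D = "deg_inner f f"
  have D: "?D > 0" using nz deg_inner_pos by blast
  let ?h = "\<lambda>v. f v / sqrt ?D"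
  define g where "g v = (if v \<in> verts G then ?h v else 0)" for v
  have "deg_inner g g = deg_inner ?h ?h" by (rule deg_inner_cong) (auto simp: g_def)
  then have "deg_inner g g = 1" using D by (simp add: deg_inner_scale)
  moreover have "deg_inner g (\<lambda>_. 1) = deg_inner ?h (\<lambda>_. 1)" by (rule deg_inner_cong) (auto simp: g_def)
  then have "deg_inner g (\<lambda>_. 1) = 0"
    using mean by (simp add: deg_inner_one flip: sum_divide_distrib)
  moreover have "dirichlet g g = dirichlet ?h ?h" by (rule dirichlet_cong) (auto simp: g_def)
  then have "dirichlet g g = dirichlet f f / deg_inner f f" using D by (simp add: dirichlet_scale)
  ultimately show ?thesis by (intro that[of g]) (auto simp: unit_sphere_def g_def)
qed

text \<open>
  Two opposite point charges, weighted by the inverse degrees, are orthogonal to the constants.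
\<close>

lemma unit_sphere_nonempty: "unit_sphere \<noteq> {}"
proof -
  obtain u where u: "u \<in> verts G" using two_verts by fastforce
  then obtain w where w: "w \<in> verts G" "w \<noteq> u" using singleton_proper[OF u] by blast
  let ?d = "\<lambda>v. real (undirected_degree G v)"
  define f where "f v = (if v = u then 1 / ?d u else 0) - (if v = w then 1 / ?d w else 0)" for v
  have d: "?d u > 0" "?d w > 0" using u w degree_pos by auto
  have "deg_inner f (\<lambda>_. 1) = (\<Sum>v\<in>verts G. (if v = u then 1 else 0) - (if v = w then 1 else 0))"
    unfolding deg_inner_one using d by (intro sum.cong refl) (auto simp: f_def)
  then have "deg_inner f (\<lambda>_. 1) = 0" using u w by (simp add: sum_subtractf)
  moreover have "\<exists>v\<in>verts G. f v \<noteq> 0" using u w d by (intro bexI[of _ u]) (auto simp: f_def)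
  ultimately show ?thesis using normalize_to_unit_sphere by blast
qed

lemma alpha1_eq:
  "alpha1 G = Inf {dirichlet f f / deg_inner f f | f.
     (\<exists>v\<in>verts G. f v \<noteq> 0) \<and> deg_inner f (\<lambda>_. 1) = 0}"
  unfolding alpha1_def dirichlet_self deg_inner_self deg_inner_one ..

lemma alpha1_minimizer:
  obtains f where "\<exists>v\<in>verts G. f v \<noteq> 0" "deg_inner f (\<lambda>_. 1) = 0"
    "dirichlet f f = alpha1 G * deg_inner f f"
    "\<And>g. deg_inner g (\<lambda>_. 1) = 0 \<Longrightarrow> alpha1 G * deg_inner g g \<le> dirichlet g g"
proof -
  have "continuous_on unit_sphere (\<lambda>f. dirichlet f f)"
    unfolding dirichlet_def
    by (intro continuous_on_sum continuous_on_mult continuous_on_diff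
          continuous_on_subset[OF continuous_on_product_coordinates]) auto
  then obtain f where f: "f \<in> unit_sphere" "\<forall>g\<in>unit_sphere. dirichlet f f \<le> dirichlet g g"
    using continuous_attains_inf[OF compact_unit_sphere unit_sphere_nonempty] by blast
  have nz: "\<exists>v\<in>verts G. f v \<noteq> 0"
  proof (rule ccontr)
    assume "\<not> ?thesis"
    then have "deg_inner f f = 0" by (simp add: deg_inner_def)
    then show False using f(1) by (simp add: unit_sphere_def)
  qed
  have mean: "deg_inner f (\<lambda>_. 1) = 0" and unit: "deg_inner f f = 1"
    using f(1) by (auto simp: unit_sphere_def)
  have min: "dirichlet f f \<le> dirichlet g g / deg_inner g g"
    if "\<exists>v\<in>verts G. g v \<noteq> 0" "deg_inner g (\<lambda>_. 1) = 0" for g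
    using normalize_to_unit_sphere[OF that] f(2) by metis
  have alpha: "alpha1 G = dirichlet f f"
    unfolding alpha1_eq
  proof (rule cInf_eq_minimum)
    show "dirichlet f f \<in> {dirichlet f f / deg_inner f f | f.
        (\<exists>v\<in>verts G. f v \<noteq> 0) \<and> deg_inner f (\<lambda>_. 1) = 0}"
      using nz mean unit by (intro CollectI exI[of _ f] conjI) simp_all
  qed (use min in blast)
  show ?thesis
  proof (rule that[OF nz mean])
    show "dirichlet f f = alpha1 G * deg_inner f f" by (simp add: alpha unit)
  next
    fix g assume g: "deg_inner g (\<lambda>_. 1) = 0"
    show "alpha1 G * deg_inner g g \<le> dirichlet g g"
    proof (cases "\<exists>v\<in>verts G. g v \<noteq> 0")
      case True
      then have "deg_inner g g > 0" using deg_inner_pos by blast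
      then show ?thesis using min[OF True g] by (simp add: alpha pos_le_divide_eq)
    next
      case False
      then have "deg_inner g g = 0" by (simp add: deg_inner_def)
      then show ?thesis using dirichlet_nonneg[of g] by simp
    qed
  qed
qed

text \<open>
  The first variation of the Rayleigh quotient at a minimiser gives the weak equation for test functions that
  are orthogonal to the constants. It extends to all test functions, as constants contribute to neither
  side.
\<close>

lemma alpha1_eigenfunction:
  obtains f where "\<exists>v\<in>verts G. f v \<noteq> 0" "\<And>g. dirichlet f g = alpha1 G * deg_inner f g"
    "deg_inner f (\<lambda>_. 1) = 0"
proof -
  obtain f where nz: "\<exists>v\<in>verts G. f v \<noteq> 0" and mean: "deg_inner f (\<lambda>_. 1) = 0"
    and eq: "dirichlet f f = alpha1 G * deg_inner f f"
    and min: "\<And>g. deg_inner g (\<lambda>_. 1) = 0 \<Longrightarrow> alpha1 G * deg_inner g g \<le> dirichlet g g"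
    using alpha1_minimizer by blast
  have "dirichlet f g = alpha1 G * deg_inner f g" for g
  proof -
    define c where "c = deg_inner g (\<lambda>_. 1) / deg_inner (\<lambda>_. 1) (\<lambda>_. 1)"
    define g0 where "g0 v = g v - c" for v
    obtain v where "v \<in> verts G" using nz by blast
    then have D1: "deg_inner (\<lambda>_. 1) (\<lambda>_. 1) > 0" by (intro deg_inner_pos) auto
    have "deg_inner g0 (\<lambda>_. 1) = deg_inner g (\<lambda>_. 1) - c * deg_inner (\<lambda>_. 1) (\<lambda>_. 1)"
      by (simp add: deg_inner_def g0_def left_diff_distrib sum_subtractf sum_distrib_left)
    then have g0: "deg_inner g0 (\<lambda>_. 1) = 0" using D1 by (simp add: c_def)
    have "0 \<le> 2 * t * (dirichlet f g0 - alpha1 G * deg_inner f g0)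
        + t\<^sup>2 * (dirichlet g0 g0 - alpha1 G * deg_inner g0 g0)" for t
    proof -
      let ?h = "\<lambda>v. f v + t * g0 v"
      have "deg_inner ?h (\<lambda>_. 1) = deg_inner f (\<lambda>_. 1) + t * deg_inner g0 (\<lambda>_. 1)"
        by (simp add: deg_inner_def sum_distrib_left algebra_simps flip: sum.distrib)
      then have "alpha1 G * deg_inner ?h ?h \<le> dirichlet ?h ?h"
        using mean g0 by (intro min) simp
      moreover have "deg_inner ?h ?h = deg_inner f f + 2 * t * deg_inner f g0 + t\<^sup>2 * deg_inner g0 g0"
        by (simp add: deg_inner_def sum_distrib_left power2_eq_square algebra_simps flip: sum.distrib)
      moreover have "dirichlet ?h ?h = dirichlet f f + 2 * t * dirichlet f g0 + t\<^sup>2 * dirichlet g0 g0"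
        by (simp add: dirichlet_def sum_distrib_left power2_eq_square algebra_simps
              flip: sum.distrib sum_subtractf)
      ultimately show ?thesis using eq by (simp add: algebra_simps)
    qed
    then have "dirichlet f g0 = alpha1 G * deg_inner f g0"
      using quadratic_nonneg_imp_zero_slope by fastforce
    moreover have "dirichlet f g0 = dirichlet f g" by (simp add: dirichlet_def g0_def)
    moreover have "deg_inner f g0 = deg_inner f g - c * deg_inner f (\<lambda>_. 1)"
      by (simp add: deg_inner_def g0_def sum_distrib_left algebra_simps flip: sum_subtractf)
    ultimately show ?thesis using mean by simp
  qed
  then show ?thesis using that nz mean by blast
qed

lemma alpha1_eigenvalue: "alpha1 G \<in> normalized_laplacian_eigenvalues G"
  using alpha1_eigenfunction unfolding eigenvalue_iff by metis

lemma alpha1_le_eigenvalue: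
  assumes "l \<in> normalized_laplacian_eigenvalues G" "l \<noteq> 0"
  shows "alpha1 G \<le> l"
proof -
  obtain f where f: "\<exists>v\<in>verts G. f v \<noteq> 0" "\<And>g. dirichlet f g = l * deg_inner f g"
    using assms(1) unfolding eigenvalue_iff by blast
  have "dirichlet f (\<lambda>_. 1) = 0" by (simp add: dirichlet_def)
  then have "deg_inner f (\<lambda>_. 1) = 0" using f(2) assms(2) by simp
  then have "alpha1 G * deg_inner f f \<le> l * deg_inner f f"
    using alpha1_minimizer f(2) by metis
  moreover have "deg_inner f f > 0" using f(1) deg_inner_pos by blast
  ultimately show ?thesis by simp
qed

text \<open>
  A minimiser with vanishing Dirichlet energy would be constant, since every cut is nonempty, and therefore zero.
\<close>

lemma alpha1_pos: "alpha1 G > 0"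
proof -
  obtain f where f: "\<exists>v\<in>verts G. f v \<noteq> 0" "deg_inner f (\<lambda>_. 1) = 0"
    "\<And>g. dirichlet f g = alpha1 G * deg_inner f g"
    using alpha1_eigenfunction by metis
  then obtain u where u: "u \<in> verts G" "f u \<noteq> 0" by blast
  have D: "deg_inner f f > 0" using u by (rule deg_inner_pos)
  have "dirichlet f f \<noteq> 0"
  proof
    assume "dirichlet f f = 0"
    then have "\<forall>e\<in>arcs G. \<bar>f (tail G e) - f (head G e)\<bar>\<^sup>2 = 0"
      unfolding dirichlet_self by (subst (asm) sum_nonneg_eq_0_iff) auto
    then have zero: "(\<Sum>e\<in>arcs G. \<bar>f (tail G e) - f (head G e)\<bar>) = 0" by simp
    have le: "f v \<le> f w" if "v \<in> verts G" "w \<in> verts G" for v w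
      using cut_coarea[OF that, of f] zero edge_connectivity_pos
      by (simp add: mult_le_0_iff)
    have const: "f v = f u" if "v \<in> verts G" for v using le[of v u] le[of u v] that u by simp
    have "deg_inner f f = f u * deg_inner f (\<lambda>_. 1)"
      unfolding deg_inner_def sum_distrib_left by (intro sum.cong refl) (simp add: const)
    then show False using f(2) D by simp
  qed
  then have "dirichlet f f > 0" using dirichlet_nonneg[of f] by simp
  then show ?thesis using D f(3)[of f] by (simp add: zero_less_mult_iff)
qed

section \<open>The spectral bound\<close>

text \<open>
  This is the weak equation tested against the positive part of \<open>f\<close>. In terms of waves, the outgoing
  derivatives at each vertex add up to zero.
\<close>

lemma pos_flux_sum_zero:
  assumes "\<And>g. dirichlet f g = (1 - cos k) * deg_inner f g"
  shows "(\<Sum>e\<in>arcs G. pos_flux k (f (tail G e)) (f (head G e))) = 0"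
proof -
  let ?g = "\<lambda>v. max (f v) 0"
  have "(\<Sum>e\<in>arcs G. pos_flux k (f (tail G e)) (f (head G e)))
      = (dirichlet f ?g - (1 - cos k) * deg_inner f ?g) / sin k"
    unfolding dirichlet_def deg_inner_conv_arcs sum_distrib_left sum_divide_distrib pos_flux_def
      sum_subtractf[symmetric]
    by (intro sum.cong refl) (simp add: algebra_simps)
  then show ?thesis using assms by simp
qed

text \<open>
  Summing the inequalities of all edges, the flux terms cancel, and the total positive length is at least the
  variation of \<open>H = disc_area (max u 0 / A)\<close>, where \<open>A\<close> is the global maximum of the waves \<open>u\<close>. Up to the
  largest vertex value \<open>M\<close>, the variation is at least \<open>\<eta>\<close> times the range of \<open>H\<close>. Above \<open>M\<close> only the edge that
  carries the maximum is available, and it is counted twice. The resulting loss of \<open>\<eta> - 2\<close> crossings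
  concerns an \<open>H\<close>-range of at most \<open>k / 2\<close>, since \<open>M \<ge> A * cos (k / 2)\<close>.
\<close>

lemma positive_part_length:
  fixes p :: "'b \<Rightarrow> real"
  assumes k: "0 < k" "k < pi"
    and eig: "\<And>g. dirichlet f g = (1 - cos k) * deg_inner f g"
    and pos: "v0 \<in> verts G" "f v0 > 0" and neg: "w \<in> verts G" "f w \<le> 0"
    and p: "\<And>e. e \<in> arcs G \<Longrightarrow> controls_pos_part (p e) k (f (tail G e)) (f (head G e))"
  shows "real (edge_connectivity G) * pi / 2 - max (real (edge_connectivity G) - 2) 0 * k / 2 \<le> sum p (arcs G)"
proof -
  let ?\<eta> = "real (edge_connectivity G)"
  let ?w = "\<lambda>e. wave k (f (tail G e)) (f (head G e))"
  have "\<exists>z\<in>{0..k}. \<forall>t\<in>{0..k}. ?w e t \<le> ?w e z" for e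
    by (rule continuous_attains_sup) (use k continuous_on_wave in auto)
  then obtain z where z: "\<And>e. z e \<in> {0..k}" "\<And>e t. t \<in> {0..k} \<Longrightarrow> ?w e t \<le> ?w e (z e)"
    by metis
  let ?tops = "(\<lambda>e. ?w e (z e)) ` arcs G"
  define A where "A = Max ?tops"
  obtain e' where e': "e' \<in> arcs G" using ex_incident_arc[OF pos(1)] by blast
  then have tops: "finite ?tops" "?tops \<noteq> {}" by auto
  then have "A \<in> ?tops" unfolding A_def by (rule Max_in)
  then obtain e0 where e0: "e0 \<in> arcs G" "A = ?w e0 (z e0)" by blast
  have wA: "?w e t \<le> A" if "e \<in> arcs G" "t \<in> {0..k}" for e t
  proof -
    have "?w e (z e) \<le> A" unfolding A_def using tops that by (intro Max_ge) auto
    then show ?thesis using z(2)[OF that(2), of e] by linarith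
  qed
  define M where "M = Max (f ` verts G)"
  have fM: "f v \<le> M" if "v \<in> verts G" for v unfolding M_def using that by auto
  have "M \<in> f ` verts G" unfolding M_def using pos by (intro Max_in) auto
  then obtain v where v: "v \<in> verts G" "f v = M" by blast
  have fA: "f u \<le> A" if u: "u \<in> verts G" for u
  proof -
    obtain e where e: "e \<in> arcs G" "tail G e = u \<or> head G e = u" by (rule ex_incident_arc[OF u])
    then show ?thesis
      using wA[OF e(1), of 0] wA[OF e(1), of k] wave_ends[OF k] k by auto
  qed
  have M: "0 < M" using fM[OF pos(1)] pos(2) by simp
  have MA: "M \<le> A" using fA[OF v(1)] v(2) by simp
  then have A: "0 < A" using M by simp
  have AM: "A * cos (k / 2) \<le> M"
    unfolding e0(2)
    by (rule wave_le_vertex_max[OF k z(1)]) (use e0(1) M fM in simp_all)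
  let ?h = "\<lambda>u. pos_level A (f u)"
  have hM: "?h u \<le> ?h v" if u: "u \<in> verts G" for u
    unfolding pos_level_def
  proof (rule disc_area_mono)
    have "0 \<le> max (f u) 0 / A" using A by simp
    then show "- 1 \<le> max (f u) 0 / A" by linarith
    show "max (f u) 0 / A \<le> max (f v) 0 / A"
      using A fM[OF u] v(2) by (intro divide_right_mono) auto
    show "max (f v) 0 / A \<le> 1" using A MA v(2) M by simp
  qed
  have hv: "?h v = disc_area (M / A)" using v M by (simp add: pos_level_def)
  have h1: "?h v \<le> pi / 2"
  proof -
    have "0 \<le> M / A" "M / A \<le> 1" using A M MA by simp_all
    then show ?thesis using disc_area_mono[of "M / A" 1] by (simp add: hv)
  qed
  have h2: "pi / 2 - ?h v \<le> k / 2"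
  proof -
    have "cos (k / 2) \<le> M / A" using AM A by (simp add: pos_le_divide_eq mult.commute)
    moreover have "cos (k / 2) \<ge> 0" using k by (intro cos_ge_zero) auto
    ultimately have "arcsin (cos (k / 2)) \<le> arcsin (M / A)"
      using A M MA by (intro arcsin_le_arcsin) auto
    moreover have "arcsin (cos (k / 2)) = pi / 2 - k / 2"
      using k by (simp add: cos_sin_eq arcsin_sin)
    ultimately show ?thesis using arcsin_le_disc_area[of "M / A"] A M MA hv by auto
  qed
  have edge: "\<bar>?h (tail G e) - ?h (head G e)\<bar> + (if e = e0 then pi - 2 * ?h v else 0)
      \<le> p e + pos_flux k (f (tail G e)) (f (head G e)) / A\<^sup>2" if e: "e \<in> arcs G" for e
  proof -
    have C: "2 * pos_level A (?w e t) - ?h (tail G e) - ?h (head G e)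
        \<le> p e + pos_flux k (f (tail G e)) (f (head G e)) / A\<^sup>2" if "t \<in> {0..k}" for t
      using p[OF e] A wA[OF e] that unfolding controls_pos_part_def by blast
    have ends: "\<bar>?h (tail G e) - ?h (head G e)\<bar> \<le> p e + pos_flux k (f (tail G e)) (f (head G e)) / A\<^sup>2"
      using C[of 0] C[of k] wave_ends[OF k] k by auto
    show ?thesis
    proof (cases "e = e0")
      case True
      have "pos_level A (?w e (z e)) = pi / 2"
        using True e0(2) A by (simp add: pos_level_def)
      then have "pi - ?h (tail G e) - ?h (head G e) \<le> p e + pos_flux k (f (tail G e)) (f (head G e)) / A\<^sup>2"
        using C[OF z(1)[of e]] by simp
      moreover have "?h (tail G e) \<le> ?h v" "?h (head G e) \<le> ?h v" using hM e by auto
      ultimately show ?thesis using True by (simp add: abs_if)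
    qed (use ends in simp)
  qed
  have "?\<eta> * ?h v \<le> (\<Sum>e\<in>arcs G. \<bar>?h (tail G e) - ?h (head G e)\<bar>)"
    using cut_coarea[OF v(1) neg(1), of ?h] pos_level_nonpos[OF neg(2)] by simp
  then have "?\<eta> * ?h v + (pi - 2 * ?h v)
      \<le> (\<Sum>e\<in>arcs G. \<bar>?h (tail G e) - ?h (head G e)\<bar> + (if e = e0 then pi - 2 * ?h v else 0))"
    using e0(1) by (simp add: sum.distrib)
  also have "\<dots> \<le> (\<Sum>e\<in>arcs G. p e + pos_flux k (f (tail G e)) (f (head G e)) / A\<^sup>2)"
    by (intro sum_mono edge)
  also have "\<dots> = sum p (arcs G)"
    using pos_flux_sum_zero[OF eig] by (simp add: sum.distrib flip: sum_divide_distrib)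
  finally have total: "?\<eta> * ?h v + (pi - 2 * ?h v) \<le> sum p (arcs G)" .
  have "(?\<eta> - 2) * (pi / 2 - ?h v) \<le> max (?\<eta> - 2) 0 * (pi / 2 - ?h v)"
    using h1 by (intro mult_right_mono) auto
  also have "\<dots> \<le> max (?\<eta> - 2) 0 * (k / 2)"
    using h2 by (intro mult_left_mono) auto
  finally show ?thesis using total by (simp add: algebra_simps)
qed

text \<open>
  The bound on the positive part applies to \<open>f\<close> and to \<open>- f\<close>, and the two parts together have at most
  the total length \<open>k\<close> times the number of edges.
\<close>

lemma eigenfunction_frequency_bound:
  assumes k: "0 < k" "k < pi"
    and nz: "\<exists>v\<in>verts G. f v \<noteq> 0" and mean: "deg_inner f (\<lambda>_. 1) = 0"
    and eig: "\<And>g. dirichlet f g = (1 - cos k) * deg_inner f g"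
  shows "pi * real (edge_connectivity G)
      \<le> k * (real (card (arcs G)) + max (real (edge_connectivity G) - 2) 0)"
proof -
  have signs: "\<exists>v\<in>verts G. g v > 0" if g: "\<exists>v\<in>verts G. g v \<noteq> 0" "deg_inner g (\<lambda>_. 1) = 0" for g
  proof (rule ccontr)
    assume "\<not> ?thesis"
    then have np: "\<And>v. v \<in> verts G \<Longrightarrow> - g v * real (undirected_degree G v) \<ge> 0"
      by (auto simp: not_less mult_le_0_iff)
    have "(\<Sum>v\<in>verts G. - g v * real (undirected_degree G v)) = 0"
      using g(2) by (simp add: deg_inner_one sum_negf)
    then have "\<forall>v\<in>verts G. - g v * real (undirected_degree G v) = 0"
      using np by (subst (asm) sum_nonneg_eq_0_iff) auto
    moreover obtain v where v: "v \<in> verts G" "g v \<noteq> 0" using g(1) by blast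
    ultimately have "- g v * real (undirected_degree G v) = 0" by blast
    then show False using v(2) degree_pos[OF v(1)] by simp
  qed
  obtain v where v: "v \<in> verts G" "f v > 0" using signs[OF nz mean] by blast
  have mean': "deg_inner (\<lambda>v. - f v) (\<lambda>_. 1) = 0"
    using mean by (simp add: deg_inner_one sum_negf)
  obtain w where w: "w \<in> verts G" "- f w > 0"
    using signs[of "\<lambda>v. - f v"] nz mean' by auto
  have eig': "dirichlet (\<lambda>v. - f v) g = (1 - cos k) * deg_inner (\<lambda>v. - f v) g" for g
  proof -
    have "dirichlet (\<lambda>v. - f v) g = - dirichlet f g"
      unfolding dirichlet_def sum_negf[symmetric] by (intro sum.cong refl) (simp add: algebra_simps)
    moreover have "deg_inner (\<lambda>v. - f v) g = - deg_inner f g"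
      unfolding deg_inner_def sum_negf[symmetric] by (intro sum.cong refl) simp
    ultimately show ?thesis using eig[of g] by simp
  qed
  obtain p n where pn: "\<And>e. p e + n e \<le> k"
    "\<And>e. controls_pos_part (p e) k (f (tail G e)) (f (head G e))"
    "\<And>e. controls_pos_part (n e) k (- f (tail G e)) (- f (head G e))"
  proof -
    have "\<forall>e. \<exists>q. fst q + snd q \<le> k \<and>
        controls_pos_part (fst q) k (f (tail G e)) (f (head G e)) \<and>
        controls_pos_part (snd q) k (- f (tail G e)) (- f (head G e))"
      using nodal_split_exists[OF k] by simp
    from choice[OF this] obtain q where "\<forall>e. fst (q e) + snd (q e) \<le> k \<and>
        controls_pos_part (fst (q e)) k (f (tail G e)) (f (head G e)) \<and>
        controls_pos_part (snd (q e)) k (- f (tail G e)) (- f (head G e))"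
      by (rule exE)
    then show ?thesis by (intro that[of "\<lambda>e. fst (q e)" "\<lambda>e. snd (q e)"]) auto
  qed
  let ?b = "real (edge_connectivity G) * pi / 2 - max (real (edge_connectivity G) - 2) 0 * k / 2"
  have "?b \<le> sum p (arcs G)"
    using positive_part_length[OF k eig v w(1)] w(2) pn(2) by simp
  moreover have "?b \<le> sum n (arcs G)"
    using positive_part_length[OF k eig' w v(1)] v(2) pn(3) by simp
  moreover have "sum p (arcs G) + sum n (arcs G) \<le> real (card (arcs G)) * k"
    unfolding sum.distrib[symmetric] by (rule sum_bounded_above) (rule pn(1))
  ultimately show ?thesis by (simp add: algebra_simps)
qed

text \<open>
  If \<open>alpha1 G \<ge> 2\<close>, the bound is trivial. Otherwise \<open>alpha1 G = 1 - cos k\<close> for some \<open>k\<close> strictly between \<open>0\<close>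
  and \<open>pi\<close>.
\<close>

lemma alpha1_lower_bound:
  "1 - cos (pi * real (edge_connectivity G) /
      (real (card (arcs G)) + max (real (edge_connectivity G) - 2) 0)) \<le> alpha1 G"
proof (cases "alpha1 G < 2")
  case False
  then show ?thesis
    using cos_ge_minus_one[of "pi * real (edge_connectivity G) /
      (real (card (arcs G)) + max (real (edge_connectivity G) - 2) 0)"] by linarith
next
  case True
  define k where "k = arccos (1 - alpha1 G)"
  have a: "-1 < 1 - alpha1 G" "1 - alpha1 G < 1" using True alpha1_pos by auto
  have k: "0 < k" "k < pi" unfolding k_def using arccos_lt_bounded[OF a] by auto
  have ck: "alpha1 G = 1 - cos k" unfolding k_def using a by (simp add: cos_arccos)
  obtain f where f: "\<exists>v\<in>verts G. f v \<noteq> 0" "deg_inner f (\<lambda>_. 1) = 0"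
    "\<And>g. dirichlet f g = (1 - cos k) * deg_inner f g"
    using alpha1_eigenfunction ck by metis
  let ?L = "real (card (arcs G)) + max (real (edge_connectivity G) - 2) 0"
  have "arcs G \<noteq> {}" using f(1) ex_incident_arc by blast
  then have L: "?L > 0" by (intro add_pos_nonneg) (auto simp: card_gt_0_iff)
  have "pi * real (edge_connectivity G) / ?L \<le> k"
    using eigenfunction_frequency_bound[OF k f] L by (simp add: pos_divide_le_eq)
  then have "cos k \<le> cos (pi * real (edge_connectivity G) / ?L)"
    using k L by (intro cos_monotone_0_pi_le) auto
  then show ?thesis using ck by simp
qed

end

theorem corollary3p10:
  fixes G :: "('a, 'b) pre_digraph"
  assumes "fin_digraph G"
    and "loopfree_digraph G"
    and "Digraph_Component.connected G"
    and "card (verts G) \<ge> 2"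
  shows "(alpha1 G \<in> normalized_laplacian_eigenvalues G \<and> alpha1 G \<noteq> 0 \<and>
          (\<forall>l \<in> normalized_laplacian_eigenvalues G. l \<noteq> 0 \<longrightarrow> alpha1 G \<le> l)) \<and>
         alpha1 G \<ge> 1 - cos (pi * real (edge_connectivity G) /
            (real (card (arcs G)) + max (real (edge_connectivity G) - 2) 0))"
proof -
  interpret connected_multigraph G
    by (intro connected_multigraph.intro connected_multigraph_axioms.intro assms)
  show ?thesis
  proof (intro conjI ballI impI)
    show "alpha1 G \<noteq> 0" using alpha1_pos by simp
  qed (fact alpha1_eigenvalue alpha1_le_eigenvalue alpha1_lower_bound)+
qed

end
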